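(* The class of balanced matroids is not closed under taking $2$-sums.
   Context: For a matroid $\mathcal{M}$ on a finite set $E$ and disjoint $I,J\subseteq E$, let $M_I^J$ denote the number of bases $B$ of $\mathcal{M}$ with $I\subseteq B$ and $B\cap J=\varnothing$. $\mathcal{M}$ is negatively correlated if $M_e^fM_f^e-M_{ef}M^{ef}\ge0$ for all distinct $e,f\in E$, and balanced if every minor of $\mathcal{M}$ is negatively correlated. For matroids $\mathcal{M},\mathcal{Q}$ with $E(\mathcal{M})\cap E(\mathcal{Q})=\{g\}$, the $2$-sum $\mathcal{M}\oplus_g\mathcal{Q}$ is the matroid on $(E(\mathcal{M})\cup E(\mathcal{Q}))\setminus\{g\}$ whose bases are the sets $B_1\cup B_2$ where either $B_1\cup\{g\}$ is a basis of $\mathcal{M}$ (with $g\notin B_1$) and $B_2$ is a basis of $\mathcal{Q}$ not containing $g$, or $B_1$ is a basis of $\mathcal{M}$ not containing $g$ and $B_2\cup\{g\}$ is a basis of $\mathcal{Q}$ (with $g\notin B_2$). *)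

theory Defs
  imports Main
begin

record 'a matroid =
  ground :: "'a set"
  bases :: "'a set set"

definition is_matroid :: "'a matroid \<Rightarrow> bool" where
  "is_matroid M \<longleftrightarrow>
     finite (ground M) \<and> bases M \<noteq> {} \<and> (\<forall>B\<in>bases M. B \<subseteq> ground M) \<and>
     (\<forall>A\<in>bases M. \<forall>B\<in>bases M. \<forall>x\<in>A - B. \<exists>y\<in>B - A. insert y (A - {x}) \<in> bases M)"

definition indep :: "'a matroid \<Rightarrow> 'a set \<Rightarrow> bool" where
  "indep M I \<longleftrightarrow> (\<exists>B\<in>bases M. I \<subseteq> B)"

definition dual :: "'a matroid \<Rightarrow> 'a matroid" where
  "dual M = \<lparr>ground = ground M, bases = {ground M - B | B. B \<in> bases M}\<rparr>"

definition delete :: "'a matroid \<Rightarrow> 'a set \<Rightarrow> 'a matroid" where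
  "delete M D = \<lparr>ground = ground M - D,
     bases = {I. I \<subseteq> ground M - D \<and> indep M I \<and>
                 (\<forall>J. J \<subseteq> ground M - D \<and> indep M J \<and> I \<subseteq> J \<longrightarrow> J = I)}\<rparr>"

definition contract :: "'a matroid \<Rightarrow> 'a set \<Rightarrow> 'a matroid" where
  "contract M C = dual (delete (dual M) C)"

definition is_minor :: "'a matroid \<Rightarrow> 'a matroid \<Rightarrow> bool" where
  "is_minor N M \<longleftrightarrow>
     (\<exists>C D. C \<subseteq> ground M \<and> D \<subseteq> ground M \<and> C \<inter> D = {} \<and> N = delete (contract M C) D)"

text \<open>\<open>num_bases M I J\<close> is the number written $M_I^J$; it is an integer so that the
  difference in the correlation inequality is not truncated.\<close>

definition num_bases :: "'a matroid \<Rightarrow> 'a set \<Rightarrow> 'a set \<Rightarrow> int" where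
  "num_bases M I J = int (card {B \<in> bases M. I \<subseteq> B \<and> B \<inter> J = {}})"

definition negatively_correlated :: "'a matroid \<Rightarrow> bool" where
  "negatively_correlated M \<longleftrightarrow>
     (\<forall>e\<in>ground M. \<forall>f\<in>ground M. e \<noteq> f \<longrightarrow>
        num_bases M {e} {f} * num_bases M {f} {e}
          - num_bases M {e, f} {} * num_bases M {} {e, f} \<ge> 0)"

definition balanced :: "'a matroid \<Rightarrow> bool" where
  "balanced M \<longleftrightarrow> (\<forall>N. is_minor N M \<longrightarrow> negatively_correlated N)"

text \<open>Intended for \<open>ground M \<inter> ground Q = {g}\<close>. If \<open>g\<close> is a loop of both matroids, or a
  coloop of both, the family of bases below is empty and the result is not a matroid.\<close>

definition two_sum :: "'a matroid \<Rightarrow> 'a \<Rightarrow> 'a matroid \<Rightarrow> 'a matroid" where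
  "two_sum M g Q = \<lparr>ground = (ground M \<union> ground Q) - {g},
     bases = {B1 \<union> B2 | B1 B2. g \<notin> B1 \<and> g \<notin> B2 \<and>
       (B1 \<union> {g} \<in> bases M \<and> B2 \<in> bases Q \<or> B1 \<in> bases M \<and> B2 \<union> {g} \<in> bases Q)}\<rparr>"

end

theory Submission
  imports Defs
begin

text \<open>The smallest non-balanced binary matroid \<open>S8\<close> becomes balanced when two of its
  circuit-hyperplanes are relaxed, but only barely: for one pair \<open>e = 3\<close>, \<open>f = 7\<close> the difference
  \<open>M_e^f M_f^e - M_{ef} M^{ef}\<close> is negative as soon as bases containing a third element
  \<open>g = 0\<close> are counted with weight \<open>2\<close>. The 2-sum along \<open>g\<close> with the uniform matroid \<open>U_{1,3}\<close>
  (that is, doubling \<open>g\<close>) produces exactly this weight. A minor of \<open>M\<close> is determined by its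
  contracted and deleted sets \<open>C, D\<close>, its bases being the \<open>B - C\<close> with \<open>C \<subseteq> B\<close> and
  \<open>B \<inter> D = {}\<close>, so balancedness is a finite family of inequalities between numbers of bases
  of \<open>M\<close> itself, which are verified by rewriting.\<close>

section \<open>Basis exchange\<close>

lemma matroid_exchange:
  assumes "is_matroid M" "A \<in> bases M" "B \<in> bases M" "x \<in> A" "x \<notin> B"
  shows "\<exists>y. y \<in> B \<and> y \<notin> A \<and> insert y (A - {x}) \<in> bases M"
  using assms unfolding is_matroid_def by blast

lemma basis_finite: "is_matroid M \<Longrightarrow> B \<in> bases M \<Longrightarrow> finite B"
  unfolding is_matroid_def using finite_subset by auto

lemma basis_subset: "is_matroid M \<Longrightarrow> B \<in> bases M \<Longrightarrow> B \<subseteq> ground M"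
  unfolding is_matroid_def by blast

text \<open>Exchanging an element of \<open>A - B\<close> for one of \<open>B\<close> shrinks
  \<open>A - B\<close> and keeps the size of \<open>A\<close>. Once \<open>A \<subseteq> B\<close>,
  exchange from the side of \<open>B\<close> shows that \<open>B - A\<close> is empty.\<close>

lemma bases_card_eq:
  assumes M: "is_matroid M" and "A \<in> bases M" "B \<in> bases M"
  shows "card A = card B"
  using assms(2)
proof (induction "card (A - B)" arbitrary: A rule: less_induct)
  case less
  note fin = basis_finite[OF M less.prems]
  show ?case
  proof (cases "A \<subseteq> B")
    case True
    then have "B \<subseteq> A"
      using matroid_exchange[OF M assms(3) less.prems] by blast
    then show ?thesis using True by simp
  next
    case False
    then obtain x where x: "x \<in> A" "x \<notin> B" by blast
    obtain y where y: "y \<in> B" "y \<notin> A" "insert y (A - {x}) \<in> bases M"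
      using matroid_exchange[OF M less.prems assms(3) x] by blast
    have "insert y (A - {x}) - B \<subset> A - B" using x y(1,2) by auto
    then have "card (insert y (A - {x}) - B) < card (A - B)"
      using fin by (simp add: psubset_card_mono)
    then have "card (insert y (A - {x})) = card B"
      using y(3) by (rule less.hyps)
    moreover have "card (insert y (A - {x})) = card A"
      using x y fin card_Suc_Diff1[OF fin x(1)] by simp
    ultimately show ?thesis by simp
  qed
qed

text \<open>A basis containing \<open>I\<close> with as few elements outside
  \<open>I \<union> A\<close> as possible has none there, since exchange against \<open>A\<close>
  would trade such an element for one of \<open>A\<close>.\<close>

lemma basis_extension:
  assumes M: "is_matroid M" and A: "A \<in> bases M" and I: "indep M I"
  shows "\<exists>B. B \<in> bases M \<and> I \<subseteq> B \<and> B \<subseteq> I \<union> A"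
proof -
  obtain B0 where "B0 \<in> bases M \<and> I \<subseteq> B0" using I unfolding indep_def by blast
  from ex_has_least_nat[where P = "\<lambda>B. B \<in> bases M \<and> I \<subseteq> B" and m = "\<lambda>B. card (B - (I \<union> A))", OF this]
  obtain B where B: "B \<in> bases M" "I \<subseteq> B"
    and min: "\<And>B'. B' \<in> bases M \<Longrightarrow> I \<subseteq> B' \<Longrightarrow> card (B - (I \<union> A)) \<le> card (B' - (I \<union> A))"
    by auto
  have "B \<subseteq> I \<union> A"
  proof (rule ccontr)
    assume "\<not> B \<subseteq> I \<union> A"
    then obtain x where x: "x \<in> B" "x \<notin> I" "x \<notin> A" by blast
    obtain y where y: "y \<in> A" "y \<notin> B" "insert y (B - {x}) \<in> bases M"
      using matroid_exchange[OF M B(1) A x(1,3)] by blast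
    have "insert y (B - {x}) - (I \<union> A) \<subset> B - (I \<union> A)" using x y(1,2) by auto
    then have "card (insert y (B - {x}) - (I \<union> A)) < card (B - (I \<union> A))"
      using basis_finite[OF M B(1)] by (simp add: psubset_card_mono)
    moreover have "I \<subseteq> insert y (B - {x})" using B x by blast
    ultimately show False using min[OF y(3)] by simp
  qed
  then show ?thesis using B by blast
qed

section \<open>Duality\<close>

lemma dual_is_matroid:
  assumes M: "is_matroid M"
  shows "is_matroid (dual M)"
proof -
  \<comment> \<open>Complementation turns exchange into this form, in which the entering element
    \<open>x\<close> is prescribed. Extending \<open>insert x (A \<inter> B)\<close> inside
    \<open>insert x A\<close> gives a basis \<open>C\<close>, which by equal cardinality misses
    exactly one element \<open>y\<close>; as \<open>C\<close> contains \<open>A \<inter> B\<close>,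
    this \<open>y\<close> lies outside \<open>B\<close>.\<close>
  have ex: "\<exists>y\<in>A - B. insert x (A - {y}) \<in> bases M"
    if A: "A \<in> bases M" and B: "B \<in> bases M" and x: "x \<in> B - A" for A B x
  proof -
    have "indep M (insert x (A \<inter> B))" using B x unfolding indep_def by blast
    then obtain C where C: "C \<in> bases M" "insert x (A \<inter> B) \<subseteq> C" "C \<subseteq> insert x A"
      using basis_extension[OF M A, of "insert x (A \<inter> B)"] by blast
    have fin: "finite A" "finite C" using basis_finite[OF M] A C by auto
    have "card (insert x A - C) = 1"
      unfolding card_Diff_subset[OF fin(2) C(3)]
      using bases_card_eq[OF M A C(1)] x fin by simp
    then obtain y where y: "insert x A - C = {y}" by (auto simp: card_1_singleton_iff)
    then have "C = insert x (A - {y})" using C(2,3) x by blast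
    moreover have "y \<in> A - B" using y C(2) by blast
    ultimately show ?thesis using C(1) by blast
  qed
  have "\<exists>y\<in>B - A. insert y (A - {x}) \<in> bases (dual M)"
    if AB: "A \<in> bases (dual M)" "B \<in> bases (dual M)" and x: "x \<in> A - B" for A B x
  proof -
    obtain A' B' where A': "A' \<in> bases M" "A = ground M - A'" and B': "B' \<in> bases M" "B = ground M - B'"
      using AB unfolding dual_def by auto
    note sub = basis_subset[OF M A'(1)] basis_subset[OF M B'(1)]
    obtain y where y: "y \<in> A' - B'" "insert x (A' - {y}) \<in> bases M"
      using ex[of A' B' x] A' B' x by blast
    have "insert y (A - {x}) = ground M - insert x (A' - {y})"
      using A' y x sub by blast
    then show ?thesis using y sub A' B' unfolding dual_def by auto
  qed
  then show ?thesis
    using M unfolding is_matroid_def dual_def by auto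
qed

section \<open>Minors\<close>

text \<open>A form of minors whose bases are read off from those of \<open>M\<close>. The family of
  bases is empty if no basis contains \<open>C\<close> and avoids \<open>D\<close>, whence the
  nonemptiness conditions below.\<close>

definition minor :: "'a matroid \<Rightarrow> 'a set \<Rightarrow> 'a set \<Rightarrow> 'a matroid" where
  "minor M C D = \<lparr>ground = ground M - (C \<union> D),
     bases = {B - C | B. B \<in> bases M \<and> C \<subseteq> B \<and> B \<inter> D = {}}\<rparr>"

lemma minor_basis:
  "B \<in> bases M \<Longrightarrow> C \<subseteq> B \<Longrightarrow> B \<inter> D = {} \<Longrightarrow> B - C \<in> bases (minor M C D)"
  unfolding minor_def by auto

lemma minor_is_matroid:
  assumes M: "is_matroid M" and ne: "bases (minor M C D) \<noteq> {}"
  shows "is_matroid (minor M C D)"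
proof -
  have "\<exists>y\<in>B - A. insert y (A - {x}) \<in> bases (minor M C D)"
    if AB: "A \<in> bases (minor M C D)" "B \<in> bases (minor M C D)" and x: "x \<in> A - B" for A B x
  proof -
    obtain A' B' where A': "A' \<in> bases M" "A = A' - C" "C \<subseteq> A'" "A' \<inter> D = {}"
      and B': "B' \<in> bases M" "B = B' - C" "C \<subseteq> B'" "B' \<inter> D = {}"
      using AB unfolding minor_def by auto
    obtain y where y: "y \<in> B'" "y \<notin> A'" "insert y (A' - {x}) \<in> bases M"
      using matroid_exchange[OF M A'(1) B'(1)] x A' B' by blast
    have "C \<subseteq> insert y (A' - {x})" "insert y (A' - {x}) \<inter> D = {}"
      using A' B' x y(1) by auto
    then have "insert y (A' - {x}) - C \<in> bases (minor M C D)"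
      using y(3) by (intro minor_basis)
    moreover have "insert y (A' - {x}) - C = insert y (A - {x})" "y \<in> B - A"
      using A' B' y(1,2) by auto
    ultimately show ?thesis by auto
  qed
  moreover have "finite (ground (minor M C D))" "\<forall>B\<in>bases (minor M C D). B \<subseteq> ground (minor M C D)"
    using M unfolding is_matroid_def minor_def by auto
  ultimately show ?thesis using ne unfolding is_matroid_def by blast
qed

lemma minor_minor:
  assumes "C' \<inter> (C \<union> D) = {}" "D' \<inter> (C \<union> D) = {}"
  shows "minor (minor M C D) C' D' = minor M (C \<union> C') (D \<union> D')"
proof -
  have bases_minor: "bases (minor N X Y) = (\<lambda>B. B - X) ` {B \<in> bases N. X \<subseteq> B \<and> B \<inter> Y = {}}"
    for N :: "'a matroid" and X Y
    unfolding minor_def by auto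
  have diff: "X - Y - Z = X - (Y \<union> Z)" for X Y Z :: "'a set"
    by auto
  have iff: "(C \<subseteq> B \<and> B \<inter> D = {}) \<and> C' \<subseteq> B - C \<and> (B - C) \<inter> D' = {} \<longleftrightarrow>
      C \<union> C' \<subseteq> B \<and> B \<inter> (D \<union> D') = {}" for B
    using assms by auto
  have "{A \<in> bases (minor M C D). C' \<subseteq> A \<and> A \<inter> D' = {}} =
      (\<lambda>B. B - C) ` {B \<in> bases M. (C \<subseteq> B \<and> B \<inter> D = {}) \<and> C' \<subseteq> B - C \<and> (B - C) \<inter> D' = {}}"
    unfolding bases_minor by auto
  then have "bases (minor (minor M C D) C' D') = bases (minor M (C \<union> C') (D \<union> D'))"
    unfolding iff bases_minor[of "minor M C D"] bases_minor[of M "C \<union> C'"] by (simp add: image_image diff)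
  moreover have "ground (minor (minor M C D) C' D') = ground (minor M (C \<union> C') (D \<union> D'))"
    unfolding minor_def by auto
  ultimately show ?thesis
    by (intro matroid.equality) simp_all
qed

text \<open>Deleting a set that is not coindependent contracts a part \<open>X\<close> of it.\<close>

lemma delete_eq_minor:
  assumes M: "is_matroid M"
  obtains X where "X \<subseteq> D" "delete M D = minor M X (D - X)" "bases (minor M X (D - X)) \<noteq> {}"
proof -
  obtain B0 where "B0 \<in> bases M" using M unfolding is_matroid_def by blast
  from ex_has_least_nat[where P = "\<lambda>B. B \<in> bases M" and m = "\<lambda>B. card (B \<inter> D)", OF this]
  obtain A where A: "A \<in> bases M" and min: "\<And>B. B \<in> bases M \<Longrightarrow> card (A \<inter> D) \<le> card (B \<inter> D)"
    by auto
  \<comment> \<open>\<open>A\<close> meets \<open>D\<close> in as few elements as a basis can; this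
    trace is the part that gets contracted.\<close>
  define X where "X = A \<inter> D"
  \<comment> \<open>A larger \<open>J\<close> would leave a basis \<open>B' \<supseteq> J\<close>
    fewer than \<open>card X\<close> elements for its trace on \<open>D\<close>, against the choice
    of \<open>A\<close>.\<close>
  have max: "J = B - X"
    if B: "B \<in> bases M" "X \<subseteq> B" and J: "J \<inter> D = {}" "indep M J" "B - X \<subseteq> J" for B J
  proof (rule ccontr)
    assume "J \<noteq> B - X"
    obtain B' where B': "B' \<in> bases M" "J \<subseteq> B'" using J unfolding indep_def by blast
    have fin: "finite B" "finite B'" using B B' basis_finite[OF M] by auto
    have fX: "finite X" using fin B finite_subset by blast
    have fJ: "finite J" using fin B' finite_subset by blast
    have "card (B - X) < card J"
      using J \<open>J \<noteq> B - X\<close> fJ by (simp add: psubset_card_mono psubset_eq)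
    moreover have "card B = card (B - X) + card X"
      using card_Diff_subset[OF fX B(2)] card_mono[OF fin(1) B(2)] by simp
    moreover have "card J + card (B' \<inter> D) \<le> card B'"
    proof -
      have "card (J \<union> (B' \<inter> D)) = card J + card (B' \<inter> D)"
        using J(1) fJ fin by (subst card_Un_disjoint) auto
      moreover have "card (J \<union> (B' \<inter> D)) \<le> card B'"
        using B' fin by (intro card_mono) auto
      ultimately show ?thesis by simp
    qed
    moreover have "card B = card B'" by (rule bases_card_eq[OF M B(1) B'(1)])
    ultimately have "card (B' \<inter> D) < card X" by linarith
    then show False using min[OF B'(1)] unfolding X_def by simp
  qed
  \<comment> \<open>When \<open>I\<close> is extended by elements of \<open>A\<close>, maximality
    admits only elements of \<open>D\<close>, hence of \<open>X\<close>; minimality of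
    \<open>card X\<close> then forces all of \<open>X\<close> in.\<close>
  have extends: "\<exists>B. I = B - X \<and> B \<in> bases M \<and> X \<subseteq> B \<and> B \<inter> (D - X) = {}"
    if I: "I \<subseteq> ground M - D" "indep M I"
      and Imax: "\<forall>J. J \<subseteq> ground M - D \<and> indep M J \<and> I \<subseteq> J \<longrightarrow> J = I" for I
  proof -
    obtain B where B: "B \<in> bases M" "I \<subseteq> B" "B \<subseteq> I \<union> A"
      using basis_extension[OF M A I(2)] by blast
    have "indep M (B - D)" using B(1) unfolding indep_def by auto
    then have "B - D = I"
      using Imax[rule_format, of "B - D"] B(2) I(1) basis_subset[OF M B(1)] by auto
    moreover have sub: "B \<inter> D \<subseteq> X" using B I unfolding X_def by blast
    moreover have "B \<inter> D = X"
      using card_seteq[OF _ sub] min[OF B(1)] basis_finite[OF M A] unfolding X_def by simp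
    ultimately show ?thesis using B(1) by (intro exI[of _ B]) auto
  qed
  have maximal: "B - X \<subseteq> ground M - D \<and> indep M (B - X) \<and>
      (\<forall>J. J \<subseteq> ground M - D \<and> indep M J \<and> B - X \<subseteq> J \<longrightarrow> J = B - X)"
    if B: "B \<in> bases M" "X \<subseteq> B" "B \<inter> (D - X) = {}" for B
  proof (intro conjI allI impI)
    show "B - X \<subseteq> ground M - D" using B(3) basis_subset[OF M B(1)] by auto
    show "indep M (B - X)" using B(1) unfolding indep_def by auto
    show "J = B - X" if "J \<subseteq> ground M - D \<and> indep M J \<and> B - X \<subseteq> J" for J
      using that by (intro max[OF B(1,2)]) auto
  qed
  have "(I \<subseteq> ground M - D \<and> indep M I \<and>
      (\<forall>J. J \<subseteq> ground M - D \<and> indep M J \<and> I \<subseteq> J \<longrightarrow> J = I)) \<longleftrightarrow>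
      (\<exists>B. I = B - X \<and> B \<in> bases M \<and> X \<subseteq> B \<and> B \<inter> (D - X) = {})" for I
    using extends[of I] maximal by (intro iffI; elim conjE exE) simp_all
  then have "bases (delete M D) = bases (minor M X (D - X))"
    unfolding delete_def minor_def by simp
  moreover have "ground (delete M D) = ground (minor M X (D - X))"
    unfolding delete_def minor_def X_def by auto
  moreover have "A - X \<in> bases (minor M X (D - X))"
    unfolding minor_def X_def using A by auto
  ultimately show thesis using that[of X] unfolding X_def by auto
qed

text \<open>Duality swaps contraction and deletion: the part \<open>X\<close> contracted when
  \<open>C\<close> is deleted from the dual becomes the deleted part here. It must be nonempty when
  \<open>C\<close> is dependent, since then no basis contains \<open>C\<close>.\<close>

lemma contract_eq_minor:
  assumes M: "is_matroid M" and C: "C \<subseteq> ground M"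
  obtains X where "X \<subseteq> C" "contract M C = minor M (C - X) X" "bases (minor M (C - X) X) \<noteq> {}"
proof -
  obtain X where X: "X \<subseteq> C" "delete (dual M) C = minor (dual M) X (C - X)"
    and ne: "bases (minor (dual M) X (C - X)) \<noteq> {}"
    using delete_eq_minor[OF dual_is_matroid[OF M]] by blast
  have "bases (contract M C) = (\<lambda>B. B - (C - X)) ` {B \<in> bases M. C - X \<subseteq> B \<and> B \<inter> X = {}}"
  proof -
    have "bases (contract M C) = (\<lambda>B. ground M - C - (ground M - B - X)) `
        {B \<in> bases M. X \<subseteq> ground M - B \<and> (ground M - B) \<inter> (C - X) = {}}"
      using X(1) unfolding contract_def X(2) unfolding minor_def dual_def by (auto simp: Un_absorb1)
    also have "\<dots> = (\<lambda>B. B - (C - X)) ` {B \<in> bases M. C - X \<subseteq> B \<and> B \<inter> X = {}}"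
    proof (rule image_cong)
      have "(X \<subseteq> ground M - B \<and> (ground M - B) \<inter> (C - X) = {}) = (C - X \<subseteq> B \<and> B \<inter> X = {})" for B
        using C X(1) by auto
      then show "{B \<in> bases M. X \<subseteq> ground M - B \<and> (ground M - B) \<inter> (C - X) = {}} =
          {B \<in> bases M. C - X \<subseteq> B \<and> B \<inter> X = {}}"
        by simp
    next
      fix B assume "B \<in> {B \<in> bases M. C - X \<subseteq> B \<and> B \<inter> X = {}}"
      then show "ground M - C - (ground M - B - X) = B - (C - X)"
        using basis_subset[OF M, of B] C X(1) by auto
    qed
    finally show ?thesis .
  qed
  also have "\<dots> = bases (minor M (C - X) X)"
    unfolding minor_def by auto
  finally have "bases (contract M C) = bases (minor M (C - X) X)" .
  moreover have "ground (contract M C) = ground (minor M (C - X) X)"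
    using X(1) unfolding contract_def X(2) unfolding minor_def dual_def by auto
  moreover have "bases (contract M C) \<noteq> {}"
    using ne unfolding contract_def X(2) unfolding dual_def by simp
  ultimately show thesis using that[of X] X(1) by auto
qed

text \<open>Composes the two reductions above. \<open>X\<close> moves from the contracted to the
  deleted set and \<open>Y\<close> the other way, so the pair obtained may differ from the one given
  by \<open>is_minor\<close>.\<close>

lemma is_minor_imp_minor:
  assumes M: "is_matroid M" and N: "is_minor N M"
  obtains C D where "C \<subseteq> ground M" "D \<subseteq> ground M" "C \<inter> D = {}" "N = minor M C D"
proof -
  obtain C D where CD: "C \<subseteq> ground M" "D \<subseteq> ground M" "C \<inter> D = {}" "N = delete (contract M C) D"
    using N unfolding is_minor_def by blast
  obtain X where X: "X \<subseteq> C" "contract M C = minor M (C - X) X" "bases (minor M (C - X) X) \<noteq> {}"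
    using contract_eq_minor[OF M CD(1)] .
  obtain Y where Y: "Y \<subseteq> D" "delete (minor M (C - X) X) D = minor (minor M (C - X) X) Y (D - Y)"
    using delete_eq_minor[OF minor_is_matroid[OF M X(3)]] .
  have N_eq: "N = minor M (C - X \<union> Y) (X \<union> (D - Y))"
    unfolding CD(4) X(2) Y(2) using X(1) Y(1) CD(3) by (intro minor_minor) auto
  show thesis
  proof (rule that[OF _ _ _ N_eq])
    show "C - X \<union> Y \<subseteq> ground M" "X \<union> (D - Y) \<subseteq> ground M" "(C - X \<union> Y) \<inter> (X \<union> (D - Y)) = {}"
      using X(1) Y(1) CD(1-3) by auto
  qed
qed

text \<open>On bases containing \<open>C\<close>, the map from \<open>B\<close> to
  \<open>B - C\<close> is injective, so counting can be done in \<open>M\<close>.\<close>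

lemma num_bases_minor:
  assumes "I \<inter> C = {}" "J \<inter> C = {}"
  shows "num_bases (minor M C D) I J = num_bases M (C \<union> I) (D \<union> J)"
proof -
  have iff: "(C \<subseteq> B \<and> B \<inter> D = {}) \<and> I \<subseteq> B - C \<and> (B - C) \<inter> J = {} \<longleftrightarrow>
      C \<union> I \<subseteq> B \<and> B \<inter> (D \<union> J) = {}" for B
    using assms by auto
  have "{B \<in> bases (minor M C D). I \<subseteq> B \<and> B \<inter> J = {}} =
      (\<lambda>B. B - C) ` {B \<in> bases M. (C \<subseteq> B \<and> B \<inter> D = {}) \<and> I \<subseteq> B - C \<and> (B - C) \<inter> J = {}}"
    unfolding minor_def by auto
  then have "{B \<in> bases (minor M C D). I \<subseteq> B \<and> B \<inter> J = {}} =
      (\<lambda>B. B - C) ` {B \<in> bases M. C \<union> I \<subseteq> B \<and> B \<inter> (D \<union> J) = {}}"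
    unfolding iff .
  moreover have "inj_on (\<lambda>B. B - C) {B \<in> bases M. C \<union> I \<subseteq> B \<and> B \<inter> (D \<union> J) = {}}"
    by (rule inj_onI) auto
  ultimately show ?thesis unfolding num_bases_def by (simp add: card_image)
qed

text \<open>Runs over all disjoint \<open>C\<close>, \<open>D\<close> instead of over minors. Pairs
  for which no basis contains \<open>C\<close> and avoids \<open>D\<close> are harmless: all four
  counts vanish.\<close>

lemma balancedI:
  assumes M: "is_matroid M"
    and le: "\<And>e f C D. \<lbrakk>e \<in> ground M; f \<in> ground M; e \<noteq> f; C \<subseteq> ground M - {e, f};
      D \<subseteq> ground M - {e, f}; C \<inter> D = {}\<rbrakk> \<Longrightarrow>
      num_bases M (insert e (insert f C)) D * num_bases M C (insert e (insert f D))
        \<le> num_bases M (insert e C) (insert f D) * num_bases M (insert f C) (insert e D)"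
  shows "balanced M"
  unfolding balanced_def
proof (intro allI impI)
  fix N assume "is_minor N M"
  then obtain C D where CD: "C \<subseteq> ground M" "D \<subseteq> ground M" "C \<inter> D = {}" "N = minor M C D"
    using is_minor_imp_minor[OF M] by blast
  show "negatively_correlated N"
    unfolding negatively_correlated_def
  proof (intro ballI impI)
    fix e f assume "e \<in> ground N" "f \<in> ground N" "e \<noteq> f"
    then have ef: "e \<in> ground M" "f \<in> ground M" "e \<noteq> f" "e \<notin> C" "e \<notin> D" "f \<notin> C" "f \<notin> D"
      unfolding CD(4) minor_def by auto
    then have "C \<subseteq> ground M - {e, f}" "D \<subseteq> ground M - {e, f}" using CD by auto
    from le[OF ef(1-3) this CD(3)]
    show "num_bases N {e} {f} * num_bases N {f} {e} - num_bases N {e, f} {} * num_bases N {} {e, f} \<ge> 0"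
      unfolding CD(4) using ef by (simp add: num_bases_minor)
  qed
qed

text \<open>Lets a failure of negative correlation in a matroid itself refute its
  balancedness.\<close>

lemma self_minor:
  assumes M: "is_matroid M"
  shows "is_minor M M"
proof -
  have [simp]: "minor M {} {} = M" unfolding minor_def by simp
  have "contract M {} = M"
    using contract_eq_minor[OF M, of "{}"] by auto
  moreover have "delete M {} = M"
    using delete_eq_minor[OF M, of "{}"] by auto
  ultimately show ?thesis unfolding is_minor_def by (intro exI[of _ "{}"]) simp
qed

section \<open>Two-sums\<close>

lemma bases_antichain:
  assumes "is_matroid M" "A \<in> bases M" "B \<in> bases M" "A \<subseteq> B"
  shows "A = B"
  using matroid_exchange[OF assms(1,3,2)] assms(4) by auto

text \<open>Keeps the two sides of a basis of the 2-sum apart, so that exchange can be argued within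
  one summand before the union is taken.\<close>

definition two_sum_pair :: "'a matroid \<Rightarrow> 'a \<Rightarrow> 'a matroid \<Rightarrow> 'a set \<Rightarrow> 'a set \<Rightarrow> bool" where
  "two_sum_pair M g Q B1 B2 \<longleftrightarrow> g \<notin> B1 \<and> g \<notin> B2 \<and>
     (insert g B1 \<in> bases M \<and> B2 \<in> bases Q \<or> B1 \<in> bases M \<and> insert g B2 \<in> bases Q)"

lemma bases_two_sum: "bases (two_sum M g Q) = {B1 \<union> B2 | B1 B2. two_sum_pair M g Q B1 B2}"
  unfolding two_sum_def two_sum_pair_def by simp

lemma ground_two_sum: "ground (two_sum M g Q) = ground M \<union> ground Q - {g}"
  unfolding two_sum_def by simp

lemma two_sum_pair_commute: "two_sum_pair M g Q B1 B2 \<longleftrightarrow> two_sum_pair Q g M B2 B1"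
  unfolding two_sum_pair_def by auto

lemma two_sum_pair_subset:
  assumes "is_matroid M" "is_matroid Q" "two_sum_pair M g Q B1 B2"
  shows "B1 \<subseteq> ground M - {g}" "B2 \<subseteq> ground Q - {g}"
  using assms basis_subset[OF assms(1)] basis_subset[OF assms(2)]
  unfolding two_sum_pair_def by auto

text \<open>The case names record whether \<open>g\<close> completes the \<open>M\<close>-side of
  \<open>A\<close> and of \<open>B\<close> (\<open>g\<close>) or not (\<open>n\<close>). Only in
  \<open>ng\<close> can exchange in \<open>M\<close> bring in \<open>g\<close> itself; then
  \<open>g\<close> changes sides, and a second exchange in \<open>Q\<close> replaces it by an
  element \<open>z\<close> of \<open>B2\<close>. This gives the second alternative of the
  conclusion.\<close>

lemma two_sum_pair_exchange:
  assumes M: "is_matroid M" and Q: "is_matroid Q"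
    and A: "two_sum_pair M g Q A1 A2" and B: "two_sum_pair M g Q B1 B2"
    and x: "x \<in> A1" "x \<notin> B1"
  shows "(\<exists>y. y \<in> B1 \<and> y \<notin> A1 \<and> two_sum_pair M g Q (insert y (A1 - {x})) A2) \<or>
    (\<exists>y. y \<in> B2 \<and> y \<notin> A2 \<and> two_sum_pair M g Q (A1 - {x}) (insert y A2))"
proof -
  have g: "g \<notin> A1" "g \<notin> A2" "g \<notin> B1" "g \<notin> B2" "x \<noteq> g"
    using A B x unfolding two_sum_pair_def by auto
  consider (gg) "insert g A1 \<in> bases M" "A2 \<in> bases Q" "insert g B1 \<in> bases M"
    | (gn) "insert g A1 \<in> bases M" "A2 \<in> bases Q" "B1 \<in> bases M"
    | (ng) "A1 \<in> bases M" "insert g A2 \<in> bases Q" "insert g B1 \<in> bases M" "B2 \<in> bases Q"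
    | (nn) "A1 \<in> bases M" "insert g A2 \<in> bases Q" "B1 \<in> bases M"
    using A B unfolding two_sum_pair_def by auto
  then show ?thesis
  proof cases
    case gg
    obtain y where y: "y \<in> insert g B1" "y \<notin> insert g A1" "insert y (insert g A1 - {x}) \<in> bases M"
      using matroid_exchange[OF M gg(1,3), of x] x g by auto
    moreover have "insert y (insert g A1 - {x}) = insert g (insert y (A1 - {x}))"
      using g by auto
    ultimately have "two_sum_pair M g Q (insert y (A1 - {x})) A2"
      using gg(2) g unfolding two_sum_pair_def by auto
    then show ?thesis using y(1,2) by auto
  next
    case gn
    obtain y where y: "y \<in> B1" "y \<notin> insert g A1" "insert y (insert g A1 - {x}) \<in> bases M"
      using matroid_exchange[OF M gn(1,3), of x] x g by auto
    moreover have "insert y (insert g A1 - {x}) = insert g (insert y (A1 - {x}))"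
      using g by auto
    ultimately have "two_sum_pair M g Q (insert y (A1 - {x})) A2"
      using gn(2) g unfolding two_sum_pair_def by auto
    then show ?thesis using y(1,2) by auto
  next
    case ng
    obtain y where y: "y \<in> insert g B1" "y \<notin> A1" "insert y (A1 - {x}) \<in> bases M"
      using matroid_exchange[OF M ng(1,3), of x] x g by auto
    show ?thesis
    proof (cases "y = g")
      case True
      obtain z where z: "z \<in> B2" "z \<notin> insert g A2" "insert z (insert g A2 - {g}) \<in> bases Q"
        using matroid_exchange[OF Q ng(2,4), of g] g by auto
      then have "two_sum_pair M g Q (A1 - {x}) (insert z A2)"
        using y(3) True g unfolding two_sum_pair_def by auto
      then show ?thesis using z(1,2) by auto
    next
      case False
      then have "two_sum_pair M g Q (insert y (A1 - {x})) A2"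
        using y(3) ng(2) g unfolding two_sum_pair_def by auto
      then show ?thesis using y(1,2) False by auto
    qed
  next
    case nn
    obtain y where y: "y \<in> B1" "y \<notin> A1" "insert y (A1 - {x}) \<in> bases M"
      using matroid_exchange[OF M nn(1,3), of x] x by auto
    then have "two_sum_pair M g Q (insert y (A1 - {x})) A2"
      using nn(2) g unfolding two_sum_pair_def by auto
    then show ?thesis using y(1,2) by auto
  qed
qed

lemma two_sum_exchange:
  assumes M: "is_matroid M" and Q: "is_matroid Q" and disj: "ground M \<inter> ground Q = {g}"
    and A: "two_sum_pair M g Q A1 A2" and B: "two_sum_pair M g Q B1 B2"
    and x: "x \<in> A1" "x \<notin> B1"
  shows "\<exists>y \<in> (B1 \<union> B2) - (A1 \<union> A2). \<exists>C1 C2. insert y ((A1 \<union> A2) - {x}) = C1 \<union> C2 \<and>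
    two_sum_pair M g Q C1 C2"
proof -
  note sub = two_sum_pair_subset[OF M Q A] two_sum_pair_subset[OF M Q B]
  from two_sum_pair_exchange[OF M Q A B x] show ?thesis
  proof (elim disjE exE conjE)
    fix y assume y: "y \<in> B1" "y \<notin> A1" "two_sum_pair M g Q (insert y (A1 - {x})) A2"
    \<comment> \<open>The ground sets share only \<open>g\<close>, which lies on no side, so
      \<open>y\<close> is not in \<open>A2\<close> and neither is \<open>x\<close>.\<close>
    have "y \<in> (B1 \<union> B2) - (A1 \<union> A2)" "insert y ((A1 \<union> A2) - {x}) = insert y (A1 - {x}) \<union> A2"
      using y(1,2) x sub disj by auto
    then show ?thesis using y(3) by blast
  next
    fix y assume y: "y \<in> B2" "y \<notin> A2" "two_sum_pair M g Q (A1 - {x}) (insert y A2)"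
    have "y \<in> (B1 \<union> B2) - (A1 \<union> A2)" "insert y ((A1 \<union> A2) - {x}) = (A1 - {x}) \<union> insert y A2"
      using y(1,2) x sub disj by auto
    then show ?thesis using y(3) by blast
  qed
qed

lemma two_sum_is_matroid:
  assumes M: "is_matroid M" and Q: "is_matroid Q" and disj: "ground M \<inter> ground Q = {g}"
    and ne: "bases (two_sum M g Q) \<noteq> {}"
  shows "is_matroid (two_sum M g Q)"
proof -
  have "\<exists>y\<in>B - A. insert y (A - {x}) \<in> bases (two_sum M g Q)"
    if AB: "A \<in> bases (two_sum M g Q)" "B \<in> bases (two_sum M g Q)" and x: "x \<in> A - B" for A B x
  proof -
    obtain A1 A2 where A: "A = A1 \<union> A2" "two_sum_pair M g Q A1 A2"
      using AB(1) unfolding bases_two_sum by auto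
    obtain B1 B2 where B: "B = B1 \<union> B2" "two_sum_pair M g Q B1 B2"
      using AB(2) unfolding bases_two_sum by auto
    have x': "x \<in> A1 \<and> x \<notin> B1 \<or> x \<in> A2 \<and> x \<notin> B2" using x A(1) B(1) by auto
    have "\<exists>y \<in> (B1 \<union> B2) - (A1 \<union> A2). \<exists>C1 C2. insert y ((A1 \<union> A2) - {x}) = C1 \<union> C2 \<and>
        two_sum_pair M g Q C1 C2"
    proof (cases "x \<in> A1 \<and> x \<notin> B1")
      case True
      then show ?thesis using two_sum_exchange[OF M Q disj A(2) B(2)] by simp
    next
      \<comment> \<open>The 2-sum is symmetric in its summands, so this is the previous case with
        \<open>M\<close> and \<open>Q\<close> interchanged.\<close>
      case False
      then have "x \<in> A2" "x \<notin> B2" using x' by auto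
      then show ?thesis
        using two_sum_exchange[OF Q M _ A(2)[unfolded two_sum_pair_commute[of M]]
            B(2)[unfolded two_sum_pair_commute[of M]]] disj
        unfolding two_sum_pair_commute[of M] by (metis Int_commute Un_commute)
    qed
    then show ?thesis unfolding A(1) B(1) bases_two_sum by blast
  qed
  moreover have "B \<subseteq> ground (two_sum M g Q)" if "B \<in> bases (two_sum M g Q)" for B
    using that two_sum_pair_subset[OF M Q] unfolding bases_two_sum ground_two_sum by blast
  moreover have "finite (ground (two_sum M g Q))"
    using M Q unfolding is_matroid_def ground_two_sum by auto
  ultimately show ?thesis using ne unfolding is_matroid_def by auto
qed

section \<open>Base counts of a 2-sum\<close>

lemma num_bases_two_sum:
  assumes M: "is_matroid M" and Q: "is_matroid Q" and disj: "ground M \<inter> ground Q = {g}"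
    and I: "I \<subseteq> ground M - {g}" and J: "J \<subseteq> ground M - {g}"
  shows "num_bases (two_sum M g Q) I J =
    num_bases M (insert g I) J * num_bases Q {} {g} + num_bases M I (insert g J) * num_bases Q {g} {}"
proof -
  \<comment> \<open>\<open>P1\<close> and \<open>P2\<close> hold pairs of full bases, with
    \<open>g\<close> in the basis of \<open>M\<close> and in that of \<open>Q\<close> respectively.
    A basis of the 2-sum arises from such a pair by dropping \<open>g\<close>, and each class
    contributes a product.\<close>
  define P1 where "P1 = {B \<in> bases M. insert g I \<subseteq> B \<and> B \<inter> J = {}} \<times> {B \<in> bases Q. {} \<subseteq> B \<and> B \<inter> {g} = {}}"
  define P2 where "P2 = {B \<in> bases M. I \<subseteq> B \<and> B \<inter> insert g J = {}} \<times> {B \<in> bases Q. {g} \<subseteq> B \<and> B \<inter> {} = {}}"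
  define h where "h = (\<lambda>(B1, B2). B1 \<union> B2 - {g})"
  have P: "B1 \<in> bases M" "B2 \<in> bases Q" "g \<in> B2 \<longleftrightarrow> g \<notin> B1" if "(B1, B2) \<in> P1 \<union> P2" for B1 B2
    using that unfolding P1_def P2_def by auto
  have "{B \<in> bases (two_sum M g Q). I \<subseteq> B \<and> B \<inter> J = {}} = h ` (P1 \<union> P2)"
  proof (intro equalityI subsetI)
    fix B assume "B \<in> {B \<in> bases (two_sum M g Q). I \<subseteq> B \<and> B \<inter> J = {}}"
    then obtain B1 B2 where B: "B = B1 \<union> B2" "two_sum_pair M g Q B1 B2" "I \<subseteq> B1 \<union> B2" "(B1 \<union> B2) \<inter> J = {}"
      unfolding bases_two_sum by auto
    note sub = two_sum_pair_subset[OF M Q B(2)]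
    have IB: "I \<subseteq> B1" using B(3) I sub(2) disj by auto
    have JB: "B1 \<inter> J = {}" using B(4) by auto
    have gB: "g \<notin> B1" "g \<notin> B2" "g \<notin> J" using sub J by auto
    consider "insert g B1 \<in> bases M" "B2 \<in> bases Q" | "B1 \<in> bases M" "insert g B2 \<in> bases Q"
      using B(2) unfolding two_sum_pair_def by auto
    then show "B \<in> h ` (P1 \<union> P2)"
    proof cases
      case 1
      have "(insert g B1, B2) \<in> P1 \<union> P2" using 1 IB JB gB unfolding P1_def by auto
      moreover have "B = h (insert g B1, B2)" unfolding B(1) h_def using gB by auto
      ultimately show ?thesis by (rule rev_image_eqI)
    next
      case 2
      have "(B1, insert g B2) \<in> P1 \<union> P2" using 2 IB JB gB unfolding P2_def by auto
      moreover have "B = h (B1, insert g B2)" unfolding B(1) h_def using gB by auto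
      ultimately show ?thesis by (rule rev_image_eqI)
    qed
  next
    fix B assume "B \<in> h ` (P1 \<union> P2)"
    then obtain B1 B2 where B: "(B1, B2) \<in> P1 \<union> P2" "B = (B1 - {g}) \<union> (B2 - {g})"
      unfolding h_def by auto
    have ins: "insert g (B1 - {g}) = B1" if "g \<in> B1" using that by auto
    have ins': "insert g (B2 - {g}) = B2" if "g \<in> B2" using that by auto
    have "two_sum_pair M g Q (B1 - {g}) (B2 - {g})"
      using P[OF B(1)] ins ins' unfolding two_sum_pair_def by (cases "g \<in> B1") auto
    then have "B \<in> bases (two_sum M g Q)" unfolding B(2) bases_two_sum by auto
    moreover have "I \<subseteq> B1" "B1 \<inter> J = {}" using B(1) unfolding P1_def P2_def by auto
    then have "I \<subseteq> B" using I unfolding B(2) by auto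
    moreover have "B2 - {g} \<subseteq> ground Q - {g}" using basis_subset[OF Q P(2)[OF B(1)]] by auto
    then have "B \<inter> J = {}" using J disj \<open>B1 \<inter> J = {}\<close> unfolding B(2) by auto
    ultimately show "B \<in> {B \<in> bases (two_sum M g Q). I \<subseteq> B \<and> B \<inter> J = {}}" by simp
  qed
  moreover have "inj_on h (P1 \<union> P2)"
  proof (rule inj_onI, clarify)
    fix A1 A2 B1 B2
    assume A: "(A1, A2) \<in> P1 \<union> P2" and B: "(B1, B2) \<in> P1 \<union> P2" and eq: "h (A1, A2) = h (B1, B2)"
    have sub: "A1 \<subseteq> ground M" "A2 \<subseteq> ground Q" "B1 \<subseteq> ground M" "B2 \<subseteq> ground Q"
      using basis_subset[OF M] basis_subset[OF Q] P[OF A] P[OF B] by auto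
    have "B1 - {g} = h (B1, B2) \<inter> ground M" "A1 - {g} = h (A1, A2) \<inter> ground M"
      "B2 - {g} = h (B1, B2) \<inter> ground Q" "A2 - {g} = h (A1, A2) \<inter> ground Q"
      using sub disj unfolding h_def by auto
    then have eqs: "A1 - {g} = B1 - {g}" "A2 - {g} = B2 - {g}" using eq by auto
    \<comment> \<open>Two bases of \<open>M\<close> that agree outside \<open>g\<close> are
      comparable, hence equal; that \<open>g\<close> lies in exactly one basis of each pair then
      settles the \<open>Q\<close>-side.\<close>
    have "A1 \<subseteq> B1 \<or> B1 \<subseteq> A1" using eqs(1) by auto
    then have "A1 = B1"
      using bases_antichain[OF M P(1)[OF A] P(1)[OF B]] bases_antichain[OF M P(1)[OF B] P(1)[OF A]] by auto
    moreover from this have "A2 = B2"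
      using eqs(2) P(3)[OF A] P(3)[OF B] by auto
    ultimately show "A1 = B1 \<and> A2 = B2" by simp
  qed
  moreover have fin: "finite (bases M)" "finite (bases Q)"
    using M Q unfolding is_matroid_def by (meson finite_Pow_iff finite_subset PowI subsetI)+
  moreover have "P1 \<inter> P2 = {}" unfolding P1_def P2_def by auto
  moreover have "finite P1" "finite P2" using fin unfolding P1_def P2_def by auto
  ultimately have "card {B \<in> bases (two_sum M g Q). I \<subseteq> B \<and> B \<inter> J = {}} = card P1 + card P2"
    by (simp add: card_image card_Un_disjoint)
  then show ?thesis
    unfolding num_bases_def P1_def P2_def by (simp add: card_cartesian_product)
qed

section \<open>Checking balancedness of an explicit matroid\<close>

definition set_system :: "'a list \<Rightarrow> 'a list list \<Rightarrow> 'a matroid" where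
  "set_system xs L = \<lparr>ground = set xs, bases = set ` set L\<rparr>"

lemma ground_set_system [simp]: "ground (set_system xs L) = set xs"
  and bases_set_system [simp]: "bases (set_system xs L) = set ` set L"
  unfolding set_system_def by simp_all

lemma num_bases_set_system:
  assumes "distinct (map set L)"
  shows "num_bases (set_system xs L) I J = int (length (filter (\<lambda>l. I \<subseteq> set l \<and> set l \<inter> J = {}) L))"
proof -
  let ?P = "\<lambda>l. I \<subseteq> set l \<and> set l \<inter> J = {}"
  have "{B \<in> bases (set_system xs L). I \<subseteq> B \<and> B \<inter> J = {}} = set (map set (filter ?P L))"
    by auto
  moreover have "distinct (map set (filter ?P L))"
    using assms by (rule distinct_map_filter)
  ultimately show ?thesis
    unfolding num_bases_def using distinct_card[of "map set (filter ?P L)"] by simp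
qed

text \<open>Makes sorted lists canonical representatives of sets, so that membership of a set among
  the bases can be tested on lists through \<open>insort\<close>.\<close>

lemma sorted_subseqs: "sorted xs \<Longrightarrow> ys \<in> set (subseqs xs) \<Longrightarrow> sorted ys"
proof (induction xs arbitrary: ys)
  case Nil
  then show ?case by simp
next
  case (Cons x xs)
  have sub: "set zs \<subseteq> set xs" if "zs \<in> set (subseqs xs)" for zs
    using that subseqs_powset[of xs] by blast
  have x: "\<forall>y\<in>set xs. x \<le> y" and xs: "sorted xs" using Cons.prems(1) by simp_all
  consider "ys \<in> set (subseqs xs)" | zs where "zs \<in> set (subseqs xs)" "ys = x # zs"
    using Cons.prems(2) by (auto simp: Let_def)
  then show ?case
  proof cases
    case 1
    then show ?thesis by (rule Cons.IH[OF xs])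
  next
    case 2
    then show ?thesis using Cons.IH[OF xs, of zs] sub[of zs] x by auto
  qed
qed

text \<open>For the independent sets \<open>I = A - {x}\<close> with \<open>A\<close> a basis, the elements completing \<open>I\<close> to a
  basis form a cocircuit, and basis exchange says that every basis meets it.\<close>

definition exchange_check :: "nat \<Rightarrow> 'a::linorder list \<Rightarrow> 'a list list \<Rightarrow> bool" where
  "exchange_check r xs L \<longleftrightarrow> L \<noteq> [] \<and> list_all (\<lambda>I. Suc (length I) = r \<longrightarrow>
     (let Y = filter (\<lambda>y. y \<notin> set I \<and> insort y I \<in> set L) xs
      in Y = [] \<or> list_all (\<lambda>B. list_ex (\<lambda>y. y \<in> set Y) B) L)) (subseqs xs)"

text \<open>Let \<open>I\<close> be the sorted list of \<open>A - {x}\<close>. Then \<open>x\<close>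
  itself is in \<open>Y\<close>, so the check makes \<open>B\<close> meet \<open>Y\<close> in some
  \<open>y\<close>; since \<open>x\<close> is not in \<open>B\<close>, this \<open>y\<close> differs
  from \<open>x\<close> and lies outside \<open>A\<close>.\<close>

lemma exchange_check_is_matroid:
  assumes check: "exchange_check r xs L" and xs: "sorted xs" "distinct xs"
    and L: "set L \<subseteq> set (subseqs xs)" and r: "\<And>l. l \<in> set L \<Longrightarrow> length l = r"
  shows "is_matroid (set_system xs L)"
proof -
  have sub: "set A \<subseteq> set xs" if "A \<in> set L" for A
    using that L subseqs_powset[of xs] by blast
  have ex: "\<exists>y. y \<in> set B \<and> y \<notin> set A \<and> insert y (set A - {x}) \<in> set ` set L"
    if A: "A \<in> set L" and B: "B \<in> set L" and x: "x \<in> set A" "x \<notin> set B" for A B x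
  proof -
    have "set A - {x} \<in> set ` set (subseqs xs)"
      unfolding subseqs_powset using sub[OF A] by auto
    then obtain I where I: "I \<in> set (subseqs xs)" "set I = set A - {x}" by auto
    have distinct: "distinct A" "distinct I"
      using subseqs_distinctD[OF _ xs(2)] A L I(1) by auto
    have sorted: "sorted A" "sorted I"
      using sorted_subseqs[OF xs(1)] A L I(1) by auto
    have "Suc (length I) = r"
      using distinct_card[OF distinct(1)] distinct_card[OF distinct(2)] I(2) r[OF A] x(1)
        card_Suc_Diff1[of "set A" x] by simp
    define Y where "Y = filter (\<lambda>y. y \<notin> set I \<and> insort y I \<in> set L) xs"
    have "insort x I = A"
      using distinct sorted I(2) x(1)
      by (intro sorted_distinct_set_unique) (auto simp: sorted_insort distinct_insort set_insort_key)
    then have "x \<in> set Y"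
      unfolding Y_def using A I(2) x(1) sub[OF A] by auto
    then have "Y \<noteq> []" by auto
    moreover have "Suc (length I) = r \<longrightarrow> Y = [] \<or> list_all (\<lambda>B. list_ex (\<lambda>y. y \<in> set Y) B) L"
      using check I(1) unfolding exchange_check_def Let_def Y_def list_all_iff[of _ "subseqs xs"] by blast
    ultimately have "list_ex (\<lambda>y. y \<in> set Y) B"
      using \<open>Suc (length I) = r\<close> B by (simp add: list_all_iff)
    then obtain y where y: "y \<in> set B" "y \<in> set Y" unfolding list_ex_iff by auto
    then have mem: "insort y I \<in> set L" "y \<notin> set I" unfolding Y_def by auto
    have "insert y (set A - {x}) = set (insort y I)"
      using I(2) by (simp add: set_insort_key)
    then have "insert y (set A - {x}) \<in> set ` set L" using mem(1) by simp
    moreover have "y \<notin> set A" using mem(2) I(2) x(2) y(1) by auto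
    ultimately show ?thesis using y(1) by auto
  qed
  have "L \<noteq> []"
    using check unfolding exchange_check_def by simp
  then show ?thesis
    unfolding is_matroid_def using ex sub by (simp add: Bex_def)
qed

text \<open>\<open>count_tree xs L\<close> is a trie over \<open>xs\<close> tabulating how many members of \<open>L\<close> meet \<open>xs\<close> in a
  given set. Labels are read only at depth \<open>length xs\<close>; carrying one at every node makes
  \<open>tree_add\<close> total without a shape invariant.\<close>

datatype trie = Zero | Node (label: int) (without: trie) (within: trie)
  where "label Zero = 0" | "without Zero = Zero" | "within Zero = Zero"

fun tree_add :: "trie \<Rightarrow> trie \<Rightarrow> trie" where
  "tree_add Zero t = t"
| "tree_add s Zero = s"
| "tree_add (Node a l r) (Node a' l' r') = Node (a + a') (tree_add l l') (tree_add r r')"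

primrec nonneg :: "trie \<Rightarrow> bool" where
  "nonneg Zero = True"
| "nonneg (Node a l r) = (0 \<le> a \<and> nonneg l \<and> nonneg r)"

primrec count_in_tree :: "'a list \<Rightarrow> 'a set \<Rightarrow> 'a set \<Rightarrow> trie \<Rightarrow> int" where
  "count_in_tree [] C D t = label t"
| "count_in_tree (x # xs) C D t =
     (if x \<in> C then 0 else count_in_tree xs C D (without t)) +
     (if x \<in> D then 0 else count_in_tree xs C D (within t))"

lemma tree_add_sel:
  "label (tree_add s t) = label s + label t"
  "without (tree_add s t) = tree_add (without s) (without t)"
  "within (tree_add s t) = tree_add (within s) (within t)"
proof -
  have [simp]: "tree_add u Zero = u" for u by (cases u) simp_all
  show "label (tree_add s t) = label s + label t"
    "without (tree_add s t) = tree_add (without s) (without t)"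
    "within (tree_add s t) = tree_add (within s) (within t)"
    by (cases s; cases t; simp)+
qed

lemma count_in_tree_add:
  "count_in_tree xs C D (tree_add s t) = count_in_tree xs C D s + count_in_tree xs C D t"
  by (induction xs arbitrary: s t) (simp_all add: tree_add_sel)

lemma count_in_tree_Zero [simp]: "count_in_tree xs C D Zero = 0"
  by (induction xs) simp_all

lemma nonneg_add: "nonneg s \<Longrightarrow> nonneg t \<Longrightarrow> nonneg (tree_add s t)"
  by (induction s t rule: tree_add.induct) simp_all

lemma nonneg_sel:
  assumes "nonneg t"
  shows "0 \<le> label t" "nonneg (without t)" "nonneg (within t)"
  using assms by (cases t; simp)+

lemma count_in_tree_nonneg: "nonneg t \<Longrightarrow> 0 \<le> count_in_tree xs C D t"
  by (induction xs arbitrary: t) (simp_all add: nonneg_sel)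

text \<open>Each remaining element is deleted, contracted or kept, whence the three recursive calls.\<close>

primrec product_check :: "nat \<Rightarrow> trie \<Rightarrow> trie \<Rightarrow> trie \<Rightarrow> trie \<Rightarrow> bool" where
  "product_check 0 a b c d \<longleftrightarrow> label c * label d \<le> label a * label b"
| "product_check (Suc n) a b c d \<longleftrightarrow> c = Zero \<or> d = Zero \<or>
     product_check n (without a) (without b) (without c) (without d) \<and>
     product_check n (within a) (within b) (within c) (within d) \<and>
     product_check n (tree_add (without a) (within a)) (tree_add (without b) (within b))
       (tree_add (without c) (within c)) (tree_add (without d) (within d))"

text \<open>Nonnegativity justifies the early exit at \<open>Zero\<close>: the left side vanishes
  and the right side is a product of nonnegative counts. Otherwise the three possible positions of
  the first element relative to \<open>C\<close> and \<open>D\<close> match the three recursive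
  checks.\<close>

lemma product_check_sound:
  assumes "product_check (length xs) a b c d" "nonneg a" "nonneg b" "nonneg c" "nonneg d" "C \<inter> D = {}"
  shows "count_in_tree xs C D c * count_in_tree xs C D d \<le> count_in_tree xs C D a * count_in_tree xs C D b"
  using assms(1-5)
proof (induction xs arbitrary: a b c d)
  case Nil
  then show ?case by simp
next
  case (Cons x xs)
  show ?case
  proof (cases "c = Zero \<or> d = Zero")
    case True
    then have "count_in_tree (x # xs) C D c * count_in_tree (x # xs) C D d = 0"
      by (auto simp del: count_in_tree.simps)
    moreover have "0 \<le> count_in_tree (x # xs) C D a * count_in_tree (x # xs) C D b"
      using Cons.prems(2,3) by (intro mult_nonneg_nonneg count_in_tree_nonneg)
    ultimately show ?thesis by (simp only:)
  next
    case False
    then have checks: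
      "product_check (length xs) (without a) (without b) (without c) (without d)"
      "product_check (length xs) (within a) (within b) (within c) (within d)"
      "product_check (length xs) (tree_add (without a) (within a)) (tree_add (without b) (within b))
        (tree_add (without c) (within c)) (tree_add (without d) (within d))"
      using Cons.prems(1) by simp_all
    note nn = Cons.prems(2-5)
    consider "x \<in> C" "x \<notin> D" | "x \<notin> C" "x \<in> D" | "x \<notin> C" "x \<notin> D" using assms(6) by auto
    then show ?thesis
    proof cases
      case 1
      then show ?thesis using Cons.IH[OF checks(2)] nn by (simp add: nonneg_sel)
    next
      case 2
      then show ?thesis using Cons.IH[OF checks(1)] nn by (simp add: nonneg_sel)
    next
      case 3
      then show ?thesis using Cons.IH[OF checks(3)] nn
        by (simp add: nonneg_sel nonneg_add count_in_tree_add)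
    qed
  qed
qed

text \<open>Empty lists become \<open>Zero\<close> at every depth, which is what the early exit of
  \<open>product_check\<close> recognises.\<close>

primrec count_tree :: "'a list \<Rightarrow> 'a list list \<Rightarrow> trie" where
  "count_tree [] L = (if L = [] then Zero else Node (int (length L)) Zero Zero)"
| "count_tree (x # xs) L = (if L = [] then Zero else
     Node 0 (count_tree xs (filter (\<lambda>l. x \<notin> set l) L)) (count_tree xs (filter (\<lambda>l. x \<in> set l) L)))"

lemma nonneg_count_tree: "nonneg (count_tree xs L)"
  by (induction xs arbitrary: L) simp_all

lemma count_in_count_tree:
  "count_in_tree xs C D (count_tree xs L) =
    int (length (filter (\<lambda>l. \<forall>x\<in>set xs. (x \<in> C \<longrightarrow> x \<in> set l) \<and> (x \<in> D \<longrightarrow> x \<notin> set l)) L))"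
proof (induction xs arbitrary: L)
  case Nil
  then show ?case by simp
next
  case (Cons x xs)
  let ?P = "\<lambda>l. \<forall>x\<in>set xs. (x \<in> C \<longrightarrow> x \<in> set l) \<and> (x \<in> D \<longrightarrow> x \<notin> set l)"
  \<comment> \<open>Splits the count by the first element; abstracting its memberships to
    \<open>c\<close>, \<open>d\<close> and \<open>Q\<close> leaves a propositional case check in the
    induction on \<open>L\<close>.\<close>
  have "int (length (filter (\<lambda>l. ((c \<longrightarrow> Q l) \<and> (d \<longrightarrow> \<not> Q l)) \<and> P l) L)) =
      (if c then 0 else int (length (filter (\<lambda>l. P l \<and> \<not> Q l) L))) +
      (if d then 0 else int (length (filter (\<lambda>l. P l \<and> Q l) L)))" for c d P Q and L :: "'a list list"
    by (induction L) auto
  from this[of "x \<in> C" "\<lambda>l. x \<in> set l" "x \<in> D" ?P L]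
  show ?case using Cons by (cases "L = []") (simp_all add: conj_commute)
qed

text \<open>\<open>e\<close> and \<open>f\<close> are not branched on, being neither contracted nor
  deleted when their correlation is tested.\<close>

definition pair_check :: "'a list \<Rightarrow> 'a list list \<Rightarrow> 'a \<Rightarrow> 'a \<Rightarrow> bool" where
  "pair_check xs L e f \<longleftrightarrow> (let ys = filter (\<lambda>x. x \<noteq> e \<and> x \<noteq> f) xs in product_check (length ys)
     (count_tree ys (filter (\<lambda>l. e \<in> set l \<and> f \<notin> set l) L))
     (count_tree ys (filter (\<lambda>l. e \<notin> set l \<and> f \<in> set l) L))
     (count_tree ys (filter (\<lambda>l. e \<in> set l \<and> f \<in> set l) L))
     (count_tree ys (filter (\<lambda>l. e \<notin> set l \<and> f \<notin> set l) L)))"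

text \<open>Pairs with \<open>e < f\<close> suffice, because the inequality is symmetric in
  \<open>e\<close> and \<open>f\<close>.\<close>

definition balanced_check :: "'a::linorder list \<Rightarrow> 'a list list \<Rightarrow> bool" where
  "balanced_check xs L \<longleftrightarrow> list_all (\<lambda>e. list_all (\<lambda>f. e < f \<longrightarrow> pair_check xs L e f) xs) xs"

lemma pair_check_sound:
  assumes L: "distinct (map set L)" and check: "pair_check xs L e f"
    and CD: "C \<subseteq> set xs - {e, f}" "D \<subseteq> set xs - {e, f}" "C \<inter> D = {}"
  defines "M \<equiv> set_system xs L"
  shows "num_bases M (insert e (insert f C)) D * num_bases M C (insert e (insert f D))
    \<le> num_bases M (insert e C) (insert f D) * num_bases M (insert f C) (insert e D)"
proof -
  define ys where "ys = filter (\<lambda>x. x \<noteq> e \<and> x \<noteq> f) xs"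
  have count: "count_in_tree ys C D (count_tree ys (filter P L)) = num_bases M I J"
    if "\<And>l. I \<subseteq> set l \<and> set l \<inter> J = {} \<longleftrightarrow> P l \<and> C \<subseteq> set l \<and> set l \<inter> D = {}" for P I J
  proof -
    have "(\<forall>x\<in>set ys. (x \<in> C \<longrightarrow> x \<in> set l) \<and> (x \<in> D \<longrightarrow> x \<notin> set l)) \<longleftrightarrow> C \<subseteq> set l \<and> set l \<inter> D = {}" for l
      using CD(1,2) unfolding ys_def by auto
    then show ?thesis
      unfolding M_def num_bases_set_system[OF L] count_in_count_tree that by (simp add: conj_commute)
  qed
  have "product_check (length ys)
     (count_tree ys (filter (\<lambda>l. e \<in> set l \<and> f \<notin> set l) L))
     (count_tree ys (filter (\<lambda>l. e \<notin> set l \<and> f \<in> set l) L))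
     (count_tree ys (filter (\<lambda>l. e \<in> set l \<and> f \<in> set l) L))
     (count_tree ys (filter (\<lambda>l. e \<notin> set l \<and> f \<notin> set l) L))"
    using check unfolding pair_check_def Let_def ys_def .
  note product_check_sound[OF this nonneg_count_tree nonneg_count_tree nonneg_count_tree nonneg_count_tree CD(3)]
  moreover have "count_in_tree ys C D (count_tree ys (filter (\<lambda>l. e \<in> set l \<and> f \<notin> set l) L)) =
      num_bases M (insert e C) (insert f D)"
    by (rule count) auto
  moreover have "count_in_tree ys C D (count_tree ys (filter (\<lambda>l. e \<notin> set l \<and> f \<in> set l) L)) =
      num_bases M (insert f C) (insert e D)"
    by (rule count) auto
  moreover have "count_in_tree ys C D (count_tree ys (filter (\<lambda>l. e \<in> set l \<and> f \<in> set l) L)) =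
      num_bases M (insert e (insert f C)) D"
    by (rule count) auto
  moreover have "count_in_tree ys C D (count_tree ys (filter (\<lambda>l. e \<notin> set l \<and> f \<notin> set l) L)) =
      num_bases M C (insert e (insert f D))"
    by (rule count) auto
  ultimately show ?thesis by simp
qed

lemma balanced_check_balanced:
  assumes M: "is_matroid (set_system xs L)" and L: "distinct (map set L)" and check: "balanced_check xs L"
  shows "balanced (set_system xs L)"
proof (rule balancedI[OF M])
  fix e f C D
  assume ef: "e \<in> ground (set_system xs L)" "f \<in> ground (set_system xs L)" "e \<noteq> f"
    and CD: "C \<subseteq> ground (set_system xs L) - {e, f}" "D \<subseteq> ground (set_system xs L) - {e, f}" "C \<inter> D = {}"
  have pair: "pair_check xs L e f" if "e \<in> set xs" "f \<in> set xs" "e < f" for e f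
    using check that unfolding balanced_check_def list_all_iff by simp
  have CD': "C \<subseteq> set xs - {e, f}" "D \<subseteq> set xs - {e, f}"
    "C \<subseteq> set xs - {f, e}" "D \<subseteq> set xs - {f, e}"
    using CD by auto
  consider "e < f" | "f < e" using ef(3) by (rule linorder_neqE)
  then show "num_bases (set_system xs L) (insert e (insert f C)) D *
      num_bases (set_system xs L) C (insert e (insert f D))
    \<le> num_bases (set_system xs L) (insert e C) (insert f D) *
      num_bases (set_system xs L) (insert f C) (insert e D)"
  proof cases
    case 1
    then show ?thesis using pair_check_sound[OF L pair CD'(1,2) CD(3)] ef by simp
  next
    case 2
    then show ?thesis using pair_check_sound[OF L pair CD'(3,4) CD(3)] ef
      by (simp add: insert_commute mult.commute)
  qed
qed

lemma distinct_map_set_filter_subseqs: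
  "distinct xs \<Longrightarrow> distinct (map set (filter P (subseqs xs)))"
  by (intro distinct_map_filter distinct_set_subseqs)

section \<open>The example\<close>

text \<open>Together with \<open>{1, 2, 3, 4}\<close> and \<open>{3, 4, 5, 6}\<close>, which are relaxed here, the excluded
  quadruples are the nonbases of \<open>S8\<close>, represented over the two-element field by the columns
  \<open>1000\<close>, \<open>0100\<close>, \<open>0010\<close>, \<open>0001\<close>, \<open>0111\<close>, \<open>1011\<close>, \<open>1101\<close>, \<open>1111\<close> for the elements \<open>0, \<dots>, 7\<close>.\<close>

definition relaxed_S8 :: "nat list list" where
  "relaxed_S8 = filter (\<lambda>l. length l = 4 \<and> l \<notin> set
    [[0, 1, 3, 6], [0, 1, 4, 5], [0, 1, 4, 7], [0, 1, 5, 7], [0, 2, 3, 5],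
     [0, 2, 4, 6], [0, 2, 4, 7], [0, 2, 6, 7], [0, 3, 4, 7], [0, 4, 5, 7],
     [0, 4, 6, 7], [1, 2, 5, 6], [1, 2, 5, 7], [1, 2, 6, 7], [1, 3, 5, 7],
     [1, 4, 5, 7], [1, 5, 6, 7], [2, 3, 6, 7], [2, 4, 6, 7], [2, 5, 6, 7]])
    (subseqs [0..<8])"

lemma distinct_relaxed_S8: "distinct (map set relaxed_S8)"
  unfolding relaxed_S8_def by (intro distinct_map_set_filter_subseqs distinct_upt)

lemma relaxed_S8_is_matroid: "is_matroid (set_system [0..<8] relaxed_S8)"
proof (rule exchange_check_is_matroid)
  show "exchange_check 4 [0..<8] relaxed_S8" by code_simp
qed (auto simp: relaxed_S8_def)

lemma relaxed_S8_balanced: "balanced (set_system [0..<8] relaxed_S8)"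
proof (rule balanced_check_balanced[OF relaxed_S8_is_matroid distinct_relaxed_S8])
  \<comment> \<open>There are 28 pairs \<open>e < f\<close>, each with at most 3^6 choices of
    \<open>C\<close> and \<open>D\<close> among the other six elements.\<close>
  show "balanced_check [0..<8] relaxed_S8" by code_simp
qed

text \<open>The element \<open>0\<close> is the one shared with the ground set of
  \<open>relaxed_S8\<close>; in the 2-sum the parallel elements \<open>8\<close> and
  \<open>9\<close> take its place.\<close>

definition U13 :: "nat list list" where
  "U13 = filter (\<lambda>l. length l = 1) (subseqs [0, 8, 9])"

lemma distinct_U13: "distinct (map set U13)"
  unfolding U13_def by (intro distinct_map_set_filter_subseqs) simp

lemma U13_is_matroid: "is_matroid (set_system [0, 8, 9] U13)"
proof (rule exchange_check_is_matroid)
  show "exchange_check 1 [0, 8, 9] U13" by code_simp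
qed (auto simp: U13_def)

lemma U13_balanced: "balanced (set_system [0, 8, 9] U13)"
proof (rule balanced_check_balanced[OF U13_is_matroid distinct_U13])
  show "balanced_check [0, 8, 9] U13" by code_simp
qed

text \<open>Each row splits one of the four counts for the pair 3, 7 by whether \<open>0\<close> is
  in the basis. The unweighted sums give 18 * 8 = 12 * 12, so the correlation inequality is tight in
  \<open>M\<close> itself and any weight on \<open>0\<close> can tip it.\<close>

lemma num_bases_relaxed_S8:
  defines "M \<equiv> set_system [0..<8] relaxed_S8"
  shows "num_bases M {0, 3} {7} = 8" "num_bases M {3} {0, 7} = 10"
    and "num_bases M {0, 7} {3} = 4" "num_bases M {7} {0, 3} = 4"
    and "num_bases M {0, 3, 7} {} = 4" "num_bases M {3, 7} {0} = 8"
    and "num_bases M {0} {3, 7} = 8" "num_bases M {} {0, 3, 7} = 4"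
  unfolding M_def num_bases_set_system[OF distinct_relaxed_S8] by code_simp+

lemma num_bases_U13:
  "num_bases (set_system [0, 8, 9] U13) {} {0} = 2"
  "num_bases (set_system [0, 8, 9] U13) {0} {} = 1"
  unfolding num_bases_set_system[OF distinct_U13] by code_simp+

theorem theorem5p11:
  "\<exists>(M :: nat matroid) (Q :: nat matroid) g.
     is_matroid M \<and> balanced M \<and> is_matroid Q \<and> balanced Q \<and>
     ground M \<inter> ground Q = {g} \<and>
     is_matroid (two_sum M g Q) \<and> \<not> balanced (two_sum M g Q)"
proof -
  define M where "M = set_system [0..<8] relaxed_S8"
  define Q where "Q = set_system [0, 8, 9] U13"
  have M: "is_matroid M" "balanced M"
    unfolding M_def by (rule relaxed_S8_is_matroid, rule relaxed_S8_balanced)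
  have Q: "is_matroid Q" "balanced Q"
    unfolding Q_def by (rule U13_is_matroid, rule U13_balanced)
  have g: "ground M \<inter> ground Q = {0}"
    unfolding M_def Q_def by auto
  \<comment> \<open>The weights 2 and 1 are the numbers of bases of \<open>U13\<close> avoiding and
    containing \<open>0\<close>.\<close>
  have num: "num_bases (two_sum M 0 Q) I J = 2 * num_bases M (insert 0 I) J + num_bases M I (insert 0 J)"
    if "I \<subseteq> {3, 7}" "J \<subseteq> {3, 7}" for I J
    using num_bases_two_sum[OF M(1) Q(1) g, of I J] that num_bases_U13
    unfolding Q_def by (force simp: M_def)
  have counts: "num_bases (two_sum M 0 Q) {3} {7} = 26" "num_bases (two_sum M 0 Q) {7} {3} = 12"
    "num_bases (two_sum M 0 Q) {3, 7} {} = 16" "num_bases (two_sum M 0 Q) {} {3, 7} = 20"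
    using num_bases_relaxed_S8[folded M_def] by (simp_all add: num)
  \<comment> \<open>A positive count rules out the degenerate 2-sum without bases.\<close>
  have "bases (two_sum M 0 Q) \<noteq> {}"
  proof
    assume "bases (two_sum M 0 Q) = {}"
    then show False using counts(1) unfolding num_bases_def by simp
  qed
  then have two_sum: "is_matroid (two_sum M 0 Q)"
    by (rule two_sum_is_matroid[OF M(1) Q(1) g])
  have ground: "3 \<in> ground (two_sum M 0 Q)" "7 \<in> ground (two_sum M 0 Q)"
    unfolding ground_two_sum M_def by simp_all
  \<comment> \<open>The difference for the pair 3, 7 is 26 * 12 - 16 * 20 = -8.\<close>
  have "\<not> negatively_correlated (two_sum M 0 Q)"
  proof
    assume "negatively_correlated (two_sum M 0 Q)"
    from this[unfolded negatively_correlated_def, rule_format, OF ground]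
    show False by (simp add: counts)
  qed
  then have "\<not> balanced (two_sum M 0 Q)"
    unfolding balanced_def using self_minor[OF two_sum] by auto
  then show ?thesis using M Q g two_sum by (intro exI conjI)
qed

end
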